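(* Let $\ell,n,d_0,\dots,d_\ell$ be positive integers, $X\in\mathbb{R}^{d_0\times n}$, $Y\in\mathbb{R}^{d_\ell\times n}$, and let $$f_{\mathrm n}:\mathbb{R}^{d_\ell\times d_{\ell-1}}\times\cdots\times\mathbb{R}^{d_1\times d_0}\to\mathbb{R},\qquad f_{\mathrm n}(W_\ell,\dots,W_1):=\|W_\ell\cdots W_1X-Y\|_F^2.$$ Let $P\in\mathbb{R}^{n\times n}$ be the orthogonal projection matrix onto $\operatorname{Im}(X^\top)$. If $\min\{d_1,\dots,d_{\ell-1}\}\ge d_0$ and $\operatorname{rk}(YP)=d_\ell$, then $f_{\mathrm n}$ has Kurdyka-Łojasiewicz exponent $1/2$ at any global minimum.
   Context: $\|\cdot\|_F$ is the Frobenius norm; $\operatorname{rk}$ denotes rank and $\operatorname{Im}$ the column space. A smooth function $f$ on a Euclidean space has Kurdyka-Łojasiewicz exponent $\alpha\in[0,1)$ at $\overline{x}$ if there exist $\rho,\eta,c>0$ such that $|\nabla f(x)|\ge c(f(x)-f(\overline{x}))^\alpha$ for all $x$ in the ball $B_\rho(\overline{x})$ with $0<f(x)-f(\overline{x})<\eta$ (in general the gradient norm is replaced by the distance from $0$ to the Clarke subdifferential, which is $\{\nabla f(x)\}$ for smooth $f$). *)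

theory Defs
  imports Complex_Main "HOL-Library.FuncSet" "Jordan_Normal_Form.DL_Rank"
begin

definition frob_inner :: "real mat \<Rightarrow> real mat \<Rightarrow> real" where
  "frob_inner A B = (\<Sum>i<dim_row A. \<Sum>j<dim_col A. A $$ (i, j) * B $$ (i, j))"

definition frob_norm :: "real mat \<Rightarrow> real" where
  "frob_norm A = sqrt (frob_inner A A)"

definition is_orth_proj_onto :: "nat \<Rightarrow> real vec set \<Rightarrow> real mat \<Rightarrow> bool" where
  "is_orth_proj_onto n S P \<longleftrightarrow>
     P \<in> carrier_mat n n \<and>
     (\<forall>v\<in>carrier_vec n. P *\<^sub>v v \<in> S \<and> (\<forall>u\<in>S. (v - P *\<^sub>v v) \<bullet> u = 0))"

(* The number and the sizes of the factors vary, so the Euclidean space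
   R^(d_l x d_(l-1)) x ... x R^(d_1 x d_0) is a carrier set: a point is a family W
   whose k-th member W k is the factor W_k, with the fixed value undefined outside
   {1..l}.  Its inner product is the sum of the Frobenius inner products. *)
definition weight_space :: "nat \<Rightarrow> (nat \<Rightarrow> nat) \<Rightarrow> (nat \<Rightarrow> real mat) set" where
  "weight_space l d = (\<Pi>\<^sub>E k\<in>{1..l}. carrier_mat (d k) (d (k - 1)))"

definition weight_diff :: "nat \<Rightarrow> (nat \<Rightarrow> real mat) \<Rightarrow> (nat \<Rightarrow> real mat) \<Rightarrow> nat \<Rightarrow> real mat" where
  "weight_diff l V W = (\<lambda>k\<in>{1..l}. V k - W k)"

definition weight_inner :: "nat \<Rightarrow> (nat \<Rightarrow> real mat) \<Rightarrow> (nat \<Rightarrow> real mat) \<Rightarrow> real" where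
  "weight_inner l V W = (\<Sum>k = 1..l. frob_inner (V k) (W k))"

definition weight_norm :: "nat \<Rightarrow> (nat \<Rightarrow> real mat) \<Rightarrow> real" where
  "weight_norm l W = sqrt (weight_inner l W W)"

(* G represents the Frechet derivative of f at W; it is unique if it exists. *)
definition has_gradient ::
    "nat \<Rightarrow> (nat \<Rightarrow> nat) \<Rightarrow> ((nat \<Rightarrow> real mat) \<Rightarrow> real) \<Rightarrow>
     (nat \<Rightarrow> real mat) \<Rightarrow> (nat \<Rightarrow> real mat) \<Rightarrow> bool" where
  "has_gradient l d f W G \<longleftrightarrow>
     G \<in> weight_space l d \<and>
     (\<forall>\<epsilon>>0. \<exists>\<delta>>0. \<forall>V\<in>weight_space l d. weight_norm l (weight_diff l V W) < \<delta> \<longrightarrow>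
        \<bar>f V - f W - weight_inner l G (weight_diff l V W)\<bar>
          \<le> \<epsilon> * weight_norm l (weight_diff l V W))"

(* For smooth f.  The existence of the gradient is part of the requirement, and
   powr is only applied to the positive number f W - f W0. *)
definition KL_exponent ::
    "nat \<Rightarrow> (nat \<Rightarrow> nat) \<Rightarrow> ((nat \<Rightarrow> real mat) \<Rightarrow> real) \<Rightarrow> real \<Rightarrow> (nat \<Rightarrow> real mat) \<Rightarrow> bool" where
  "KL_exponent l d f \<alpha> W0 \<longleftrightarrow>
     0 \<le> \<alpha> \<and> \<alpha> < 1 \<and>
     (\<exists>\<rho>>0. \<exists>\<eta>>0. \<exists>c>0. \<forall>W\<in>weight_space l d.
        weight_norm l (weight_diff l W W0) < \<rho> \<and> 0 < f W - f W0 \<and> f W - f W0 < \<eta> \<longrightarrow>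
        (\<exists>G. has_gradient l d f W G \<and> c * (f W - f W0) powr \<alpha> \<le> weight_norm l G))"

(* weight_prod d W k = W_k * ... * W_1, starting from the identity matrix of size d_0 *)
primrec weight_prod :: "(nat \<Rightarrow> nat) \<Rightarrow> (nat \<Rightarrow> real mat) \<Rightarrow> nat \<Rightarrow> real mat" where
  "weight_prod d W 0 = 1\<^sub>m (d 0)"
| "weight_prod d W (Suc k) = W (Suc k) * weight_prod d W k"

definition f_n ::
    "nat \<Rightarrow> (nat \<Rightarrow> nat) \<Rightarrow> real mat \<Rightarrow> real mat \<Rightarrow> (nat \<Rightarrow> real mat) \<Rightarrow> real" where
  "f_n l d X Y W = (frob_norm (weight_prod d W l * X - Y))\<^sup>2"

end

theory Submission
  imports Defs "HOL-Analysis.L2_Norm"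
begin

text \<open>Write \<open>A = W\<^sub>l \<cdots> W\<^sub>1\<close> and \<open>M = A X - Y P\<close>.  The matrix \<open>P\<close> is symmetric and idempotent, and
\<open>X P = X\<close>, so that \<open>M = M P\<close> is orthogonal to \<open>Y P - Y\<close> and Pythagoras
(\<open>frob_norm_residual_pythagoras\<close>) gives \<open>f = \<parallel>M\<parallel>\<^sup>2 + \<parallel>Y P - Y\<parallel>\<^sup>2\<close>.  Because no hidden layer is narrower than
the input, every matrix of the right size is a product of factors (\<open>weight_prod_surj\<close>), and one
of them satisfies \<open>A X = Y P\<close>.  Hence a global minimum has \<open>M = 0\<close> (\<open>global_min_product\<close>), and the
gap between \<open>f\<close> and its minimum is exactly \<open>\<parallel>M\<parallel>\<^sup>2\<close>.  For the exponent \<open>1/2\<close> it is therefore enough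
to bound \<open>\<parallel>M\<parallel>\<close> by a multiple of the norm of the gradient.

The partial gradient with respect to the first factor \<open>W\<^sub>1\<close> already suffices.  It equals
\<open>2 B\<^sup>T (A X - Y) X\<^sup>T\<close> with \<open>B = W\<^sub>l \<cdots> W\<^sub>2\<close>, and neither of the two outer multiplications can make the
residual much smaller:

\<^item> Each column of \<open>P\<close> lies in the column space of \<open>X\<^sup>T\<close>, so \<open>P = X\<^sup>T Q\<close> for some \<open>Q\<close>.  Thus
  \<open>M = M P = M X\<^sup>T Q\<close>, and \<open>M X\<^sup>T = (A X - Y) X\<^sup>T\<close>; so \<open>\<parallel>M\<parallel> \<le> \<parallel>(A X - Y) X\<^sup>T\<parallel> \<parallel>Q\<parallel>\<close>
  (\<open>frob_norm_residual_le\<close>).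

\<^item> At the minimum, \<open>B W\<^sub>1 X = Y P\<close> has full row rank and hence a right inverse \<open>S\<close>, so that
  \<open>R = W\<^sub>1 X S\<close> is a right inverse of \<open>B\<close>.  Therefore \<open>B\<^sup>T\<close> is injective, with a lower bound which survives
  a small perturbation of \<open>B\<close> (\<open>frob_norm_le_transpose_mult_near_right_invertible\<close>).

The gradient itself comes from a first-order expansion of the matrix product with a remainder that
is quadratic in the size of the perturbation (\<open>weight_prod_expansion\<close>, \<open>has_gradient_f_n\<close>).  The
same expansion shows that \<open>B\<close> depends continuously on the factors.\<close>

section \<open>The Frobenius inner product and norm\<close>

lemma frob_inner_commute:
  assumes "A \<in> carrier_mat r c" "B \<in> carrier_mat r c"
  shows "frob_inner A B = frob_inner B A"
  using assms by (simp add: frob_inner_def mult.commute)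

lemma frob_inner_add_left:
  assumes "A \<in> carrier_mat r c" "B \<in> carrier_mat r c" 
  shows "frob_inner (A + B) N = frob_inner A N + frob_inner B N"
  using assms by (simp add: frob_inner_def algebra_simps sum.distrib)

lemma frob_inner_add_right:
  assumes "N \<in> carrier_mat r c" "A \<in> carrier_mat r c" "B \<in> carrier_mat r c" 
  shows "frob_inner N (A + B) = frob_inner N A + frob_inner N B"
  using assms by (simp add: frob_inner_def algebra_simps sum.distrib)

lemma frob_inner_minus_right:
  assumes "N \<in> carrier_mat r c" "A \<in> carrier_mat r c" "B \<in> carrier_mat r c" 
  shows "frob_inner N (A - B) = frob_inner N A - frob_inner N B"
  using assms by (simp add: frob_inner_def algebra_simps sum_subtractf)

lemma frob_inner_smult_left:
  "frob_inner (s \<cdot>\<^sub>m A) N = s * frob_inner A N" if "A \<in> carrier_mat r c" 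
  using that by (simp add: frob_inner_def sum_distrib_left mult.assoc)

lemma frob_norm_nonneg: "0 \<le> frob_norm A"
  by (simp add: frob_norm_def frob_inner_def sum_nonneg)

lemma frob_norm_power2: "(frob_norm A)\<^sup>2 = frob_inner A A"
  by (simp add: frob_norm_def frob_inner_def sum_nonneg)

lemma frob_inner_mult_left:
  assumes "A \<in> carrier_mat a b" "B \<in> carrier_mat b c" "N \<in> carrier_mat a c"
  shows "frob_inner (A * B) N = frob_inner A (N * B\<^sup>T)"
proof -
  have "frob_inner (A * B) N = (\<Sum>i<a. \<Sum>j<c. \<Sum>k<b. A $$ (i, k) * B $$ (k, j) * N $$ (i, j))"
    using assms by (simp add: frob_inner_def scalar_prod_def sum_distrib_right lessThan_atLeast0)
  also have "\<dots> = (\<Sum>i<a. \<Sum>k<b. \<Sum>j<c. A $$ (i, k) * B $$ (k, j) * N $$ (i, j))"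
    by (intro sum.cong sum.swap refl)
  also have "\<dots> = frob_inner A (N * B\<^sup>T)"
    using assms by (simp add: frob_inner_def scalar_prod_def sum_distrib_left lessThan_atLeast0 mult_ac)
  finally show ?thesis .
qed

lemma frob_inner_mult_right:
  assumes "A \<in> carrier_mat a b" "B \<in> carrier_mat b c" "N \<in> carrier_mat a c"
  shows "frob_inner (A * B) N = frob_inner B (A\<^sup>T * N)"
proof -
  have "frob_inner (A * B) N = (\<Sum>i<a. \<Sum>j<c. \<Sum>k<b. A $$ (i, k) * B $$ (k, j) * N $$ (i, j))"
    using assms by (simp add: frob_inner_def scalar_prod_def sum_distrib_right lessThan_atLeast0)
  also have "\<dots> = (\<Sum>i<a. \<Sum>k<b. \<Sum>j<c. A $$ (i, k) * B $$ (k, j) * N $$ (i, j))"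
    by (intro sum.cong sum.swap refl)
  also have "\<dots> = (\<Sum>k<b. \<Sum>i<a. \<Sum>j<c. A $$ (i, k) * B $$ (k, j) * N $$ (i, j))"
    by (rule sum.swap)
  also have "\<dots> = (\<Sum>k<b. \<Sum>j<c. \<Sum>i<a. A $$ (i, k) * B $$ (k, j) * N $$ (i, j))"
    by (intro sum.cong sum.swap refl)
  also have "\<dots> = frob_inner B (A\<^sup>T * N)"
    using assms by (simp add: frob_inner_def scalar_prod_def sum_distrib_left lessThan_atLeast0 mult_ac)
  finally show ?thesis .
qed

text \<open>Reading a matrix as a function on its index pairs makes the triangle and Cauchy--Schwarz
inequalities those of \<^const>\<open>L2_set\<close>.\<close>

lemma frob_norm_eq_L2_set:
  assumes "A \<in> carrier_mat r c"
  shows "frob_norm A = L2_set (($$) A) ({..<r} \<times> {..<c})"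
  using assms
  by (simp add: frob_norm_def frob_inner_def L2_set_def power2_eq_square sum.cartesian_product
      case_prod_unfold)

lemma frob_norm_transpose: "frob_norm A\<^sup>T = frob_norm A"
  unfolding frob_norm_def frob_inner_def
  by (subst sum.swap) simp

lemma frob_norm_triangle:
  assumes "A \<in> carrier_mat r c" "B \<in> carrier_mat r c"
  shows "frob_norm (A + B) \<le> frob_norm A + frob_norm B"
proof -
  have "frob_norm (A + B) = L2_set (\<lambda>p. A $$ p + B $$ p) ({..<r} \<times> {..<c})"
    using assms by (subst frob_norm_eq_L2_set[of _ r c]) (auto intro!: L2_set_cong)
  also have "\<dots> \<le> frob_norm A + frob_norm B"
    using assms by (simp add: frob_norm_eq_L2_set L2_set_triangle_ineq)
  finally show ?thesis .
qed

lemma frob_inner_le_norms: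
  assumes "A \<in> carrier_mat r c" "B \<in> carrier_mat r c"
  shows "\<bar>frob_inner A B\<bar> \<le> frob_norm A * frob_norm B"
proof -
  have "\<bar>frob_inner A B\<bar> = \<bar>\<Sum>p\<in>{..<r} \<times> {..<c}. A $$ p * B $$ p\<bar>"
    using assms by (simp add: frob_inner_def sum.cartesian_product case_prod_unfold)
  also have "\<dots> \<le> (\<Sum>p\<in>{..<r} \<times> {..<c}. \<bar>A $$ p\<bar> * \<bar>B $$ p\<bar>)"
    unfolding abs_mult[symmetric] by (rule sum_abs)
  also have "\<dots> \<le> frob_norm A * frob_norm B"
    using assms by (simp add: frob_norm_eq_L2_set L2_set_mult_ineq)
  finally show ?thesis .
qed

lemma frob_norm_mult_le:
  assumes "A \<in> carrier_mat a b" "B \<in> carrier_mat b c"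
  shows "frob_norm (A * B) \<le> frob_norm A * frob_norm B"
proof (rule power2_le_imp_le)
  have cs: "((A * B) $$ (i, j))\<^sup>2 \<le> (\<Sum>k<b. (A $$ (i, k))\<^sup>2) * (\<Sum>k<b. (B $$ (k, j))\<^sup>2)"
    if "i < a" "j < c" for i j
  proof -
    have "\<bar>\<Sum>k<b. A $$ (i, k) * B $$ (k, j)\<bar> \<le> (\<Sum>k<b. \<bar>A $$ (i, k)\<bar> * \<bar>B $$ (k, j)\<bar>)"
      unfolding abs_mult[symmetric] by (rule sum_abs)
    also have "\<dots> \<le> L2_set (\<lambda>k. A $$ (i, k)) {..<b} * L2_set (\<lambda>k. B $$ (k, j)) {..<b}"
      by (rule L2_set_mult_ineq)
    finally have *: "\<bar>\<Sum>k<b. A $$ (i, k) * B $$ (k, j)\<bar>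
        \<le> L2_set (\<lambda>k. A $$ (i, k)) {..<b} * L2_set (\<lambda>k. B $$ (k, j)) {..<b}" .
    have "(\<Sum>k<b. A $$ (i, k) * B $$ (k, j))\<^sup>2
        \<le> (L2_set (\<lambda>k. A $$ (i, k)) {..<b} * L2_set (\<lambda>k. B $$ (k, j)) {..<b})\<^sup>2"
      using power_mono[OF * abs_ge_zero, of 2] by (simp only: power2_abs)
    then show ?thesis
      using assms that
      by (simp add: power_mult_distrib L2_set_def sum_nonneg scalar_prod_def lessThan_atLeast0)
  qed
  have "(frob_norm (A * B))\<^sup>2 = (\<Sum>i<a. \<Sum>j<c. ((A * B) $$ (i, j))\<^sup>2)"
    unfolding frob_norm_power2 using assms by (simp add: frob_inner_def power2_eq_square)
  also have "\<dots> \<le> (\<Sum>i<a. \<Sum>j<c. (\<Sum>k<b. (A $$ (i, k))\<^sup>2) * (\<Sum>k<b. (B $$ (k, j))\<^sup>2))"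
    by (intro sum_mono cs) auto
  also have "\<dots> = (\<Sum>i<a. \<Sum>k<b. (A $$ (i, k))\<^sup>2) * (\<Sum>j<c. \<Sum>k<b. (B $$ (k, j))\<^sup>2)"
    by (simp add: sum_product)
  also have "(\<Sum>j<c. \<Sum>k<b. (B $$ (k, j))\<^sup>2) = (\<Sum>k<b. \<Sum>j<c. (B $$ (k, j))\<^sup>2)"
    by (rule sum.swap)
  finally show "(frob_norm (A * B))\<^sup>2 \<le> (frob_norm A * frob_norm B)\<^sup>2"
    using assms unfolding power_mult_distrib frob_norm_power2
    by (simp add: frob_inner_def power2_eq_square)
qed (simp add: frob_norm_nonneg)

lemma frob_norm_add_power2:
  assumes "A \<in> carrier_mat r c" "B \<in> carrier_mat r c"
  shows "(frob_norm (A + B))\<^sup>2 = (frob_norm A)\<^sup>2 + 2 * frob_inner A B + (frob_norm B)\<^sup>2"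
  using assms frob_inner_commute[OF assms]
  by (simp add: frob_norm_power2 frob_inner_add_left[OF assms]
      frob_inner_add_right[of _ r c])

lemma frob_norm_eq_0_imp:
  assumes "A \<in> carrier_mat r c" "frob_norm A = 0"
  shows "A = 0\<^sub>m r c"
  using assms by (auto simp: frob_norm_eq_L2_set L2_set_eq_0_iff intro!: eq_matI)

lemma frob_norm_smult: "frob_norm (s \<cdot>\<^sub>m A) = \<bar>s\<bar> * frob_norm A"
proof -
  have "frob_inner (s \<cdot>\<^sub>m A) (s \<cdot>\<^sub>m A) = s\<^sup>2 * frob_inner A A"
    by (simp add: frob_inner_def sum_distrib_left power2_eq_square mult_ac)
  then show ?thesis by (simp add: frob_norm_def real_sqrt_mult)
qed

section \<open>Column spaces, right inverses and the orthogonal projection\<close>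

text \<open>A maximal independent set of columns has as many elements as the dimension of the whole space, so
it is a basis of it.\<close>

lemma (in vec_space) full_row_rank_imp_col_space:
  assumes A: "A \<in> carrier_mat n nc" and "rank A = n"
  shows "col_space A = carrier_vec n"
proof -
  have cols: "set (cols A) \<subseteq> carrier_vec n" using A cols_dim by blast
  obtain U where U: "maximal U (\<lambda>T. T \<subseteq> set (cols A) \<and> lin_indpt T)"
    using maximal_exists_superset[of "set (cols A)" "\<lambda>T. T \<subseteq> set (cols A) \<and> lin_indpt T" "{}"]
    by (auto simp: lin_dep_def)
  then have U': "U \<subseteq> set (cols A)" "lin_indpt U" by (auto simp: maximal_def)
  have "card U = dim" using rank_card_indpt[OF A U] assms(2) dim_is_n by simp
  then have "basis U"
    using U' cols by (intro dim_li_is_basis) (auto intro: finite_subset)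
  then have "span U = carrier_vec n" by (auto simp: basis_def)
  moreover have "span U \<subseteq> span (set (cols A))" by (rule span_is_monotone[OF U'(1)])
  ultimately show ?thesis
    using span_closed[OF cols] unfolding col_space_def by (metis subsetI subset_antisym)
qed

lemma col_space_factor:
  assumes A: "(A :: real mat) \<in> carrier_mat r c" and B: "B \<in> carrier_mat r m"
    and cols: "\<And>j. j < m \<Longrightarrow> col B j \<in> vec_space.col_space r A"
  obtains R where "R \<in> carrier_mat c m" "A * R = B"
proof -
  interpret vec_space "TYPE(real)" r .
  have "\<forall>j\<in>{..<m}. \<exists>x. x \<in> carrier_vec c \<and> A *\<^sub>v x = col B j"
    using cols A by (auto simp: col_space_eq[OF A])
  then obtain q where q: "\<And>j. j < m \<Longrightarrow> q j \<in> carrier_vec c \<and> A *\<^sub>v q j = col B j"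
    by (metis lessThan_iff)
  let ?R = "mat c m (\<lambda>(i, j). q j $ i)"
  have "A * ?R = B"
  proof (rule mat_col_eqI)
    fix j assume "j < dim_col B"
    then have j: "j < m" using B by simp
    have "col (A * ?R) j = A *\<^sub>v col ?R j"
      using A j by (intro col_mult2[of _ r c _ m]) auto
    also have "col ?R j = q j" using q[OF j] j by auto
    finally show "col (A * ?R) j = col B j" using q[OF j] by simp
  qed (use A B in auto)
  then show ?thesis using that[of ?R] by auto
qed

lemma right_inverse_of_full_row_rank:
  assumes A: "(A :: real mat) \<in> carrier_mat r c" and "vec_space.rank r A = r"
  obtains R where "R \<in> carrier_mat c r" "A * R = 1\<^sub>m r"
proof (rule col_space_factor[OF A one_carrier_mat])
  show "col (1\<^sub>m r) j \<in> vec_space.col_space r A" for j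
    unfolding vec_space.full_row_rank_imp_col_space[OF assms]
    using col_dim[of "1\<^sub>m r" j] by simp
qed


text \<open>Orthogonality of \<open>v - P v\<close> to the rows of \<open>X\<close> gives \<open>X P = X\<close>.  Transposed and combined with
\<open>P = X\<^sup>T Q\<close>, this yields \<open>P\<^sup>T P = P\<close>; the left-hand side is symmetric, and so symmetry and
idempotence both follow.\<close>

lemma orth_proj_onto_row_space:
  assumes X: "X \<in> carrier_mat m n"
    and P: "is_orth_proj_onto n (vec_space.col_space n X\<^sup>T) P"
  obtains Q where "Q \<in> carrier_mat m n" "X\<^sup>T * Q = P" "X * P = X" "P\<^sup>T = P" "P * P = P"
proof -
  interpret vec_space "TYPE(real)" n .
  have Pc: "P \<in> carrier_mat n n"
    and PS: "\<And>v. v \<in> carrier_vec n \<Longrightarrow> P *\<^sub>v v \<in> col_space X\<^sup>T"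
    and orth: "\<And>v u. v \<in> carrier_vec n \<Longrightarrow> u \<in> col_space X\<^sup>T \<Longrightarrow> (v - P *\<^sub>v v) \<bullet> u = 0"
    using P by (auto simp: is_orth_proj_onto_def)
  have Pu: "P *\<^sub>v unit_vec n j = col P j" if "j < n" for j
    using Pc that by (intro eq_vecI) (auto simp: scalar_prod_right_unit)
  have XT: "X\<^sup>T \<in> carrier_mat n m" using X by simp
  obtain Q where Q: "Q \<in> carrier_mat m n" "X\<^sup>T * Q = P"
  proof (rule col_space_factor[OF XT Pc])
    show "col P j \<in> col_space X\<^sup>T" if "j < n" for j
      using PS[of "unit_vec n j"] Pu[OF that] by simp
  qed
  have XP: "X * P = X"
  proof (rule eq_matI)
    fix i j assume "i < dim_row X" "j < dim_col X"
    then have i: "i < m" and j: "j < n" using X by auto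
    have "row X i \<in> set (cols X\<^sup>T)"
      using i X by (auto simp: Matrix.rows_def)
    then have "row X i \<in> col_space X\<^sup>T"
      unfolding col_space_def using X by (intro span_mem) (auto simp: Matrix.rows_def)
    then have "(unit_vec n j - col P j) \<bullet> row X i = 0"
      using orth[of "unit_vec n j" "row X i"] Pu[OF j] by simp
    moreover have "(unit_vec n j - col P j) \<bullet> row X i = unit_vec n j \<bullet> row X i - col P j \<bullet> row X i"
      using Pc X i j by (intro minus_scalar_prod_distrib[of _ n]) auto
    moreover have "unit_vec n j \<bullet> row X i = X $$ (i, j)"
      using X i j by (subst scalar_prod_left_unit[of _ n]) auto
    moreover have "col P j \<bullet> row X i = row X i \<bullet> col P j"
      using X i j Pc by (intro comm_scalar_prod[of _ n]) auto
    ultimately show "(X * P) $$ (i, j) = X $$ (i, j)"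
      using X Pc i j by simp
  qed (use X Pc in auto)
  have "P\<^sup>T * P = P"
  proof -
    have "P\<^sup>T * X\<^sup>T = X\<^sup>T" using transpose_mult[OF X Pc] XP by simp
    then have "P\<^sup>T * (X\<^sup>T * Q) = X\<^sup>T * Q"
      using assoc_mult_mat[of "P\<^sup>T" n n "X\<^sup>T" m Q n] Pc XT Q(1) by simp
    then show ?thesis using Q(2) by simp
  qed
  moreover from this have "P\<^sup>T = P"
    using transpose_mult[of "P\<^sup>T" n n P n] Pc by simp
  ultimately show ?thesis using that Q XP by simp
qed

section \<open>The residual of the least squares problem\<close>

lemma mat_telescope:
  fixes A B C :: "real mat"
  assumes "A \<in> carrier_mat r c" "B \<in> carrier_mat r c" "C \<in> carrier_mat r c"
  shows "A - C = (A - B) + (B - C)"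
  using assms by (intro eq_matI) auto

lemma residual_split:
  fixes X Y P A :: "real mat"
  assumes X: "X \<in> carrier_mat m n" and Y: "Y \<in> carrier_mat r n" and P: "P \<in> carrier_mat n n"
    and A: "A \<in> carrier_mat r m"
  shows "A * X - Y = (A * X - Y * P) + (Y * P - Y)"
  by (rule mat_telescope[OF mult_carrier_mat[OF A X] mult_carrier_mat[OF Y P] Y])

lemma residual_mult_proj:
  fixes X Y P A :: "real mat"
  assumes X: "X \<in> carrier_mat m n" and Y: "Y \<in> carrier_mat r n" and P: "P \<in> carrier_mat n n"
    and XP: "X * P = X" and PP: "P * P = P" and A: "A \<in> carrier_mat r m"
  shows "(A * X - Y * P) * P = A * X - Y * P"
proof -
  have "(A * X - Y * P) * P = A * X * P - Y * P * P"
    by (rule minus_mult_distrib_mat[of _ r n _ _ n]) (use assms in auto)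
  also have "A * X * P = A * (X * P)" by (rule assoc_mult_mat[OF A X P])
  also have "Y * P * P = Y * (P * P)" by (rule assoc_mult_mat[OF Y P P])
  finally show ?thesis by (simp add: XP PP)
qed

lemma frob_norm_residual_pythagoras:
  assumes X: "X \<in> carrier_mat m n" and Y: "Y \<in> carrier_mat r n" and P: "P \<in> carrier_mat n n"
    and XP: "X * P = X" and PT: "P\<^sup>T = P" and PP: "P * P = P" and A: "A \<in> carrier_mat r m"
  shows "(frob_norm (A * X - Y))\<^sup>2 = (frob_norm (A * X - Y * P))\<^sup>2 + (frob_norm (Y * P - Y))\<^sup>2"
proof -
  let ?M = "A * X - Y * P" and ?Z = "Y * P - Y"
  have c: "?M \<in> carrier_mat r n" "?Z \<in> carrier_mat r n" using A X Y P by auto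
  have "frob_inner ?M ?Z = frob_inner (?M * P) ?Z"
    by (simp add: residual_mult_proj[OF X Y P XP PP A])
  also have "\<dots> = frob_inner ?M (?Z * P)"
    using frob_inner_mult_left[OF c(1) P c(2)] PT by simp
  also have "?Z * P = 0\<^sub>m r n"
  proof -
    have "?Z * P = Y * P * P - Y * P"
      by (rule minus_mult_distrib_mat[of _ r n _ _ n]) (use X Y P in auto)
    also have "Y * P * P = Y * (P * P)" by (rule assoc_mult_mat[OF Y P P])
    finally show ?thesis using PP Y P by auto
  qed
  also have "frob_inner ?M (0\<^sub>m r n) = 0"
    unfolding frob_inner_def carrier_matD[OF c(1)] by simp
  finally show ?thesis
    unfolding residual_split[OF X Y P A] frob_norm_add_power2[OF c] by simp
qed

text \<open>Multiplication by \<open>X\<^sup>T\<close> annihilates the unattainable part \<open>Y P - Y\<close> of the residual \<open>A X - Y\<close>, while \<open>Q\<close> undoes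
it on the part \<open>A X - Y P\<close>.\<close>

lemma frob_norm_residual_le:
  assumes X: "X \<in> carrier_mat m n" and Y: "Y \<in> carrier_mat r n" and P: "P \<in> carrier_mat n n"
    and XP: "X * P = X" and PT: "P\<^sup>T = P" and PP: "P * P = P" and A: "A \<in> carrier_mat r m"
    and Q: "Q \<in> carrier_mat m n" "X\<^sup>T * Q = P"
  shows "frob_norm (A * X - Y * P) \<le> frob_norm ((A * X - Y) * X\<^sup>T) * frob_norm Q"
proof -
  let ?M = "A * X - Y * P" and ?Z = "Y * P - Y"
  have c: "?M \<in> carrier_mat r n" "?Z \<in> carrier_mat r n" using A X Y P by auto
  have XT: "X\<^sup>T \<in> carrier_mat n m" using X by simp
  have "?Z * X\<^sup>T = Y * P * X\<^sup>T - Y * X\<^sup>T"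
    by (rule minus_mult_distrib_mat[of _ r n _ _ m]) (use X Y P in auto)
  also have "Y * P * X\<^sup>T = Y * (P * X\<^sup>T)" by (rule assoc_mult_mat[OF Y P XT])
  also have "P * X\<^sup>T = X\<^sup>T" using transpose_mult[OF X P] XP PT by simp
  finally have "?Z * X\<^sup>T = 0\<^sub>m r m" using X Y by auto
  then have "(A * X - Y) * X\<^sup>T = ?M * X\<^sup>T"
    using residual_split[OF X Y P A] add_mult_distrib_mat[OF c XT] c XT by simp
  moreover have "?M = ?M * X\<^sup>T * Q"
    using residual_mult_proj[OF X Y P XP PP A] assoc_mult_mat[OF c(1) XT Q(1)] Q(2) by simp
  ultimately show ?thesis
    using frob_norm_mult_le[of "?M * X\<^sup>T" r m Q n] c XT Q(1) by (metis mult_carrier_mat)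
qed

section \<open>Products of factors\<close>

text \<open>Membership in \<^const>\<open>weight_space\<close> without the extensionality condition, so that it is inherited
by initial segments, by shifted families and by pointwise differences.\<close>

definition conforms :: "nat \<Rightarrow> (nat \<Rightarrow> nat) \<Rightarrow> (nat \<Rightarrow> real mat) \<Rightarrow> bool" where
  "conforms m d W \<longleftrightarrow> (\<forall>k\<in>{1..m}. W k \<in> carrier_mat (d k) (d (k - 1)))"

lemma conforms_Suc:
  "conforms (Suc m) d W \<longleftrightarrow> conforms m d W \<and> W (Suc m) \<in> carrier_mat (d (Suc m)) (d m)"
  unfolding conforms_def
  by (metis Suc_eq_plus1 add_diff_cancel_right' atLeastAtMostSuc_conv insert_iff le_add2)

lemma conforms_first_factor: "conforms (Suc m) d W \<Longrightarrow> W 1 \<in> carrier_mat (d 1) (d 0)"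
  unfolding conforms_def by (drule bspec[of _ _ 1]) auto

lemma conforms_diff:
  "conforms m d V \<Longrightarrow> conforms m d W \<Longrightarrow> conforms m d (\<lambda>k. V k - W k)"
  unfolding conforms_def by (meson minus_carrier_mat)

lemma weight_space_conforms: "W \<in> weight_space l d \<Longrightarrow> conforms l d W"
  by (auto simp: weight_space_def conforms_def)

lemma weight_prod_carrier:
  "conforms m d W \<Longrightarrow> weight_prod d W m \<in> carrier_mat (d m) (d 0)"
  by (induction m) (auto simp: conforms_Suc)

lemma conforms_shift:
  "conforms (Suc m) d W \<Longrightarrow> conforms m (\<lambda>i. d (Suc i)) (\<lambda>i. W (Suc i))"
  by (force simp: conforms_def)

text \<open>Splitting off the first factor turns the product of the remaining ones into a \<^const>\<open>weight_prod\<close>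
of the shifted family, to which everything known about \<^const>\<open>weight_prod\<close> applies again.\<close>

lemma weight_prod_first_factor:
  assumes "conforms (Suc m) d W"
  shows "weight_prod d W (Suc m) = weight_prod (\<lambda>i. d (Suc i)) (\<lambda>i. W (Suc i)) m * W 1"
  using assms
proof (induction m)
  case 0
  then have "W (Suc 0) \<in> carrier_mat (d (Suc 0)) (d 0)"
    using conforms_Suc[of 0 d W] by blast
  then show ?case by simp
next
  case (Suc m)
  have c: "conforms (Suc m) d W" "W (Suc (Suc m)) \<in> carrier_mat (d (Suc (Suc m))) (d (Suc m))"
    using Suc.prems conforms_Suc by blast+
  have "W 1 \<in> carrier_mat (d (Suc 0)) (d 0)"
    using conforms_first_factor[OF c(1)] by simp
  then show ?case
    using Suc.IH[OF c(1)] weight_prod_carrier[OF conforms_shift[OF c(1)]] c(2)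
    by (simp add: assoc_mult_mat[of _ "d (Suc (Suc m))" "d (Suc m)" _ "d (Suc 0)" _ "d 0"])
qed

text \<open>All factors but the last embed the input space by the rectangular identity; this loses nothing as
the layers are wide enough.  The last factor is the given matrix, padded by zero columns.\<close>

lemma weight_prod_surj:
  assumes "l > 0" and A: "A \<in> carrier_mat (d l) (d 0)"
    and wide: "\<And>k. k \<in> {1..<l} \<Longrightarrow> d 0 \<le> d k"
  obtains W where "W \<in> weight_space l d" "weight_prod d W l = A"
proof -
  define W where "W = (\<lambda>k\<in>{1..l}. if k = l
      then mat (d l) (d (l - 1)) (\<lambda>(i, j). if j < d 0 then A $$ (i, j) else 0)
      else mat (d k) (d (k - 1)) (\<lambda>(i, j). if i = j then 1 else 0))"
  have wide': "d 0 \<le> d k" if "k < l" for k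
    using that wide[of k] by (cases k) auto
  have "W \<in> weight_space l d" by (auto simp: W_def weight_space_def)
  moreover have "weight_prod d W k = mat (d k) (d 0) (\<lambda>(i, j). if i = j then 1 else 0)"
    if "k < l" for k
    using that
  proof (induction k)
    case 0
    then show ?case by (auto simp: one_mat_def)
  next
    case (Suc k)
    then have IH: "weight_prod d W k = mat (d k) (d 0) (\<lambda>(i, j). if i = j then 1 else 0)" by simp
    have "d 0 \<le> d k" using wide' Suc.prems by simp
    then show ?case
      unfolding weight_prod.simps IH using Suc.prems
      by (intro eq_matI)
        (auto simp: W_def scalar_prod_def if_distrib[of "\<lambda>x. x * _"] cong: if_cong)
  qed
  moreover obtain k where l: "l = Suc k" using assms(1) by (cases l) auto
  ultimately have *: "weight_prod d W k = mat (d k) (d 0) (\<lambda>(i, j). if i = j then 1 else 0)"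
    by simp
  have "d 0 \<le> d k" using wide' l by simp
  then have "weight_prod d W l = A"
    unfolding l weight_prod.simps *
  proof (intro eq_matI)
    fix i j assume "i < dim_row A" "j < dim_col A"
    then have ij: "i < d (Suc k)" "j < d 0" "j < d k" using A l \<open>d 0 \<le> d k\<close> by auto
    have "(W (Suc k) * mat (d k) (d 0) (\<lambda>(i, j). if i = j then 1 else 0)) $$ (i, j)
        = (\<Sum>p\<in>{0..<d k}. (if p < d 0 then A $$ (i, p) else 0) * (if p = j then 1 else 0))"
      using ij by (simp add: W_def l scalar_prod_def)
    also have "\<dots> = (\<Sum>p\<in>{0..<d k}. if p = j then A $$ (i, j) else 0)"
      using ij by (intro sum.cong) auto
    finally show "(W (Suc k) * mat (d k) (d 0) (\<lambda>(i, j). if i = j then 1 else 0)) $$ (i, j) = A $$ (i, j)"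
      using ij by simp
  qed (use A l in \<open>auto simp: W_def\<close>)
  with \<open>W \<in> weight_space l d\<close> show ?thesis using that by blast
qed

section \<open>First-order expansion of the product\<close>

text \<open>The derivative of the product at \<open>W\<close> in the direction \<open>H\<close>, by the Leibniz rule.\<close>

primrec weight_deriv ::
    "(nat \<Rightarrow> nat) \<Rightarrow> (nat \<Rightarrow> real mat) \<Rightarrow> (nat \<Rightarrow> real mat) \<Rightarrow> nat \<Rightarrow> real mat" where
  "weight_deriv d W H 0 = 0\<^sub>m (d 0) (d 0)"
| "weight_deriv d W H (Suc k) = H (Suc k) * weight_prod d W k + W (Suc k) * weight_deriv d W H k"

lemma weight_deriv_carrier:
  "conforms m d W \<Longrightarrow> conforms m d H \<Longrightarrow> weight_deriv d W H m \<in> carrier_mat (d m) (d 0)"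
  by (induction m) (auto simp: conforms_Suc intro: weight_prod_carrier)

lemma weight_deriv_cong:
  "(\<And>k. k \<in> {1..m} \<Longrightarrow> H k = H' k) \<Longrightarrow> weight_deriv d W H m = weight_deriv d W H' m"
  by (induction m) auto

lemma mat_telescope3:
  fixes A B C E :: "real mat"
  assumes "A \<in> carrier_mat r c" "B \<in> carrier_mat r c" "C \<in> carrier_mat r c" "E \<in> carrier_mat r c"
  shows "A - E = (A - B - C) + (C + (B - E))"
  using assms by (intro eq_matI) auto

lemma mat_cancel_middle:
  fixes A B C E :: "real mat"
  assumes "A \<in> carrier_mat r c" "B \<in> carrier_mat r c" "C \<in> carrier_mat r c" "E \<in> carrier_mat r c"
  shows "A + (B + C) - (B + E) = A + (C - E)"
  using assms by (intro eq_matI) auto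

text \<open>With \<open>v, w\<close> the products of the first \<open>m\<close> factors and \<open>H = V\<^sub>m\<^sub>+\<^sub>1 - W\<^sub>m\<^sub>+\<^sub>1\<close>, the difference of the products
of \<open>m + 1\<close> factors is \<open>H (v - w) + H w + W\<^sub>m\<^sub>+\<^sub>1 (v - w)\<close>.  The first term is of second order,
the second belongs to the derivative, and the induction hypothesis applies to the third.  The
restriction to \<open>t \<le> 1\<close> lets \<open>t\<^sup>2\<close> be absorbed into \<open>t\<close>.\<close>

lemma weight_prod_expansion:
  assumes "conforms m d W"
  shows "\<exists>C\<ge>0. \<forall>V t. conforms m d V \<longrightarrow> 0 \<le> t \<longrightarrow> t \<le> 1 \<longrightarrow>
      (\<forall>k\<in>{1..m}. frob_norm (V k - W k) \<le> t) \<longrightarrow>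
      frob_norm (weight_prod d V m - weight_prod d W m) \<le> C * t \<and>
      frob_norm (weight_prod d V m - weight_prod d W m
            - weight_deriv d W (\<lambda>k. V k - W k) m) \<le> C * t\<^sup>2"
  using assms
proof (induction m)
  case 0
  have "frob_norm (1\<^sub>m k - 1\<^sub>m k) = 0" "frob_norm (1\<^sub>m k - 1\<^sub>m k - 0\<^sub>m k k) = 0" for k
    by (auto simp: frob_norm_def frob_inner_def)
  then show ?case by (intro exI[of _ 0]) simp
next
  case (Suc m)
  let ?w = "weight_prod d W m" and ?U = "W (Suc m)"
  have W: "conforms m d W" and U: "?U \<in> carrier_mat (d (Suc m)) (d m)"
    using Suc.prems conforms_Suc by blast+
  note w = weight_prod_carrier[OF W]
  from Suc.IH[OF W] obtain C where C: "C \<ge> 0" and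
    IH: "\<And>V t. \<lbrakk>conforms m d V; 0 \<le> t; t \<le> 1; \<And>k. k \<in> {1..m} \<Longrightarrow> frob_norm (V k - W k) \<le> t\<rbrakk>
      \<Longrightarrow> frob_norm (weight_prod d V m - ?w) \<le> C * t \<and>
          frob_norm (weight_prod d V m - ?w - weight_deriv d W (\<lambda>k. V k - W k) m) \<le> C * t\<^sup>2"
    by auto
  let ?C = "frob_norm ?w + C + frob_norm ?U * C"
  have "frob_norm (weight_prod d V (Suc m) - weight_prod d W (Suc m)) \<le> ?C * t \<and>
      frob_norm (weight_prod d V (Suc m) - weight_prod d W (Suc m)
          - weight_deriv d W (\<lambda>k. V k - W k) (Suc m)) \<le> ?C * t\<^sup>2"
    if V': "conforms (Suc m) d V" and t: "0 \<le> t" "t \<le> 1"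
      and le: "\<forall>k\<in>{1..Suc m}. frob_norm (V k - W k) \<le> t" for V t
  proof -
    have V: "conforms m d V" and T: "V (Suc m) \<in> carrier_mat (d (Suc m)) (d m)"
      using V' conforms_Suc by blast+
    let ?v = "weight_prod d V m" and ?H = "V (Suc m) - ?U"
    let ?D = "weight_deriv d W (\<lambda>k. V k - W k) m"
    note v = weight_prod_carrier[OF V]
    have H: "?H \<in> carrier_mat (d (Suc m)) (d m)" using T U by auto
    have D: "?D \<in> carrier_mat (d m) (d 0)"
      by (rule weight_deriv_carrier[OF W conforms_diff[OF V W]])
    have Ht: "frob_norm ?H \<le> t" using le by simp
    have IH1: "frob_norm (?v - ?w) \<le> C * t" and IH2: "frob_norm (?v - ?w - ?D) \<le> C * t\<^sup>2"
      using IH[OF V t] le by auto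
    have vw: "?v - ?w \<in> carrier_mat (d m) (d 0)" "?v - ?w - ?D \<in> carrier_mat (d m) (d 0)"
      using v w D by auto
    have first: "V (Suc m) * ?v - ?U * ?w = ?H * (?v - ?w) + (?H * ?w + ?U * (?v - ?w))"
      unfolding mult_minus_distrib_mat[OF U v w] mult_minus_distrib_mat[OF H v w]
        minus_mult_distrib_mat[OF T U v]
      by (rule mat_telescope3[OF mult_carrier_mat[OF T v] mult_carrier_mat[OF U v]
            mult_carrier_mat[OF H w] mult_carrier_mat[OF U w]])
    have second: "V (Suc m) * ?v - ?U * ?w - (?H * ?w + ?U * ?D)
        = ?H * (?v - ?w) + ?U * (?v - ?w - ?D)"
      unfolding first mult_minus_distrib_mat[OF U vw(1) D]
      by (rule mat_cancel_middle[OF mult_carrier_mat[OF H vw(1)] mult_carrier_mat[OF H w]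
            mult_carrier_mat[OF U vw(1)] mult_carrier_mat[OF U D]])
    have Hvw: "frob_norm (?H * (?v - ?w)) \<le> C * t\<^sup>2"
    proof -
      have "frob_norm (?H * (?v - ?w)) \<le> frob_norm ?H * frob_norm (?v - ?w)"
        by (rule frob_norm_mult_le[OF H vw(1)])
      also have "\<dots> \<le> t * (C * t)"
        by (intro mult_mono Ht IH1 t frob_norm_nonneg)
      finally show ?thesis by (simp add: power2_eq_square mult_ac)
    qed
    have "frob_norm (?H * ?w) \<le> t * frob_norm ?w"
      using frob_norm_mult_le[OF H w] Ht frob_norm_nonneg[of ?w]
      by (meson mult_right_mono order_trans)
    moreover have "frob_norm (?U * (?v - ?w)) \<le> frob_norm ?U * (C * t)"
      using frob_norm_mult_le[OF U vw(1)] IH1 frob_norm_nonneg[of ?U]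
      by (meson mult_left_mono order_trans)
    moreover have "frob_norm (?H * (?v - ?w)) \<le> C * t"
    proof -
      have "t\<^sup>2 \<le> t" using t by (simp add: power2_eq_square mult_left_le)
      then show ?thesis using Hvw C by (meson mult_left_mono order_trans)
    qed
    moreover have "frob_norm (V (Suc m) * ?v - ?U * ?w)
        \<le> frob_norm (?H * (?v - ?w)) + (frob_norm (?H * ?w) + frob_norm (?U * (?v - ?w)))"
      unfolding first
      using frob_norm_triangle[OF mult_carrier_mat[OF H vw(1)]
          add_carrier_mat[OF mult_carrier_mat[OF U vw(1)], of "?H * ?w"]]
        frob_norm_triangle[OF mult_carrier_mat[OF H w] mult_carrier_mat[OF U vw(1)]]
      by simp
    ultimately have 1: "frob_norm (V (Suc m) * ?v - ?U * ?w) \<le> ?C * t"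
      by (simp add: algebra_simps)
    have "frob_norm (?U * (?v - ?w - ?D)) \<le> frob_norm ?U * (C * t\<^sup>2)"
      using frob_norm_mult_le[OF U vw(2)] IH2 frob_norm_nonneg[of ?U]
      by (meson mult_left_mono order_trans)
    moreover have "frob_norm (V (Suc m) * ?v - ?U * ?w - (?H * ?w + ?U * ?D))
        \<le> frob_norm (?H * (?v - ?w)) + frob_norm (?U * (?v - ?w - ?D))"
      unfolding second
      by (rule frob_norm_triangle[OF mult_carrier_mat[OF H vw(1)] mult_carrier_mat[OF U vw(2)]])
    moreover have "0 \<le> frob_norm ?w * t\<^sup>2" by (simp add: frob_norm_nonneg)
    ultimately have 2: "frob_norm (V (Suc m) * ?v - ?U * ?w - (?H * ?w + ?U * ?D)) \<le> ?C * t\<^sup>2"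
      using Hvw by (simp add: algebra_simps)
    show ?thesis using 1 2 by simp
  qed
  moreover have "?C \<ge> 0" using C by (simp add: frob_norm_nonneg)
  ultimately show ?case by blast
qed

section \<open>The gradient of the loss\<close>

text \<open>The adjoint of \<^const>\<open>weight_deriv\<close>: the \<open>k\<close>-th member is
\<open>(W\<^sub>m \<cdots> W\<^sub>k\<^sub>+\<^sub>1)\<^sup>T N (W\<^sub>k\<^sub>-\<^sub>1 \<cdots> W\<^sub>1)\<^sup>T\<close>, computed from the last factor down as in
backpropagation.  The value \<^const>\<open>undefined\<close> outside the index range is the one prescribed by
\<^const>\<open>weight_space\<close>.\<close>

primrec weight_grad ::
    "(nat \<Rightarrow> nat) \<Rightarrow> (nat \<Rightarrow> real mat) \<Rightarrow> nat \<Rightarrow> real mat \<Rightarrow> nat \<Rightarrow> real mat" where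
  "weight_grad d W 0 N = (\<lambda>_. undefined)"
| "weight_grad d W (Suc k) N =
     (weight_grad d W k ((W (Suc k))\<^sup>T * N))(Suc k := N * (weight_prod d W k)\<^sup>T)"

lemma weight_grad_in_weight_space:
  assumes "conforms m d W" "N \<in> carrier_mat (d m) (d 0)"
  shows "weight_grad d W m N \<in> weight_space m d"
  using assms
proof (induction m arbitrary: N)
  case 0
  then show ?case by (simp add: weight_space_def)
next
  case (Suc m)
  have W: "conforms m d W" and U: "W (Suc m) \<in> carrier_mat (d (Suc m)) (d m)"
    using Suc.prems(1) conforms_Suc by blast+
  have "weight_grad d W m ((W (Suc m))\<^sup>T * N) \<in> weight_space m d"
    using U Suc.prems(2) by (intro Suc.IH[OF W]) auto
  moreover have "N * (weight_prod d W m)\<^sup>T \<in> carrier_mat (d (Suc m)) (d m)"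
    using weight_prod_carrier[OF W] Suc.prems(2) by auto
  ultimately show ?case
    by (auto simp: weight_space_def PiE_def Pi_def extensional_def)
qed

lemma weight_inner_weight_grad:
  assumes "conforms m d W" "conforms m d H" "N \<in> carrier_mat (d m) (d 0)"
  shows "weight_inner m (weight_grad d W m N) H = frob_inner N (weight_deriv d W H m)"
  using assms
proof (induction m arbitrary: N)
  case 0
  then show ?case by (simp add: weight_inner_def frob_inner_def)
next
  case (Suc m)
  have W: "conforms m d W" and U: "W (Suc m) \<in> carrier_mat (d (Suc m)) (d m)"
    using Suc.prems(1) conforms_Suc by blast+
  have H: "conforms m d H" and T: "H (Suc m) \<in> carrier_mat (d (Suc m)) (d m)"
    using Suc.prems(2) conforms_Suc by blast+
  note N = Suc.prems(3) and w = weight_prod_carrier[OF W] and D = weight_deriv_carrier[OF W H]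
  have UN: "(W (Suc m))\<^sup>T * N \<in> carrier_mat (d m) (d 0)" using U N by auto
  have Nw: "N * (weight_prod d W m)\<^sup>T \<in> carrier_mat (d (Suc m)) (d m)" using w N by auto
  have Hw: "H (Suc m) * weight_prod d W m \<in> carrier_mat (d (Suc m)) (d 0)" using T w by auto
  have UD: "W (Suc m) * weight_deriv d W H m \<in> carrier_mat (d (Suc m)) (d 0)" using U D by auto
  have "weight_inner (Suc m) (weight_grad d W (Suc m) N) H
      = weight_inner m (weight_grad d W m ((W (Suc m))\<^sup>T * N)) H
        + frob_inner (N * (weight_prod d W m)\<^sup>T) (H (Suc m))"
    by (simp add: weight_inner_def)
  also have "\<dots> = frob_inner ((W (Suc m))\<^sup>T * N) (weight_deriv d W H m)
        + frob_inner (N * (weight_prod d W m)\<^sup>T) (H (Suc m))"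
    using Suc.IH[OF W H UN] by simp
  also have "\<dots> = frob_inner (W (Suc m) * weight_deriv d W H m) N
        + frob_inner (H (Suc m) * weight_prod d W m) N"
    using frob_inner_mult_right[OF U D N] frob_inner_mult_left[OF T w N]
      frob_inner_commute[OF UN D] frob_inner_commute[OF Nw T] by simp
  also have "\<dots> = frob_inner N (weight_deriv d W H (Suc m))"
    using frob_inner_commute[OF Hw N] frob_inner_commute[OF UD N]
      frob_inner_add_right[OF N Hw UD] by simp
  finally show ?case .
qed

lemma weight_grad_first_factor:
  assumes "conforms (Suc m) d W" "N \<in> carrier_mat (d (Suc m)) (d 0)"
  shows "weight_grad d W (Suc m) N 1 = (weight_prod (\<lambda>i. d (Suc i)) (\<lambda>i. W (Suc i)) m)\<^sup>T * N"
  using assms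
proof (induction m arbitrary: N)
  case 0
  then show ?case by simp
next
  case (Suc m)
  have W: "conforms (Suc m) d W" and U: "W (Suc (Suc m)) \<in> carrier_mat (d (Suc (Suc m))) (d (Suc m))"
    using Suc.prems(1) conforms_Suc by blast+
  note b = weight_prod_carrier[OF conforms_shift[OF W]]
  have UN: "(W (Suc (Suc m)))\<^sup>T * N \<in> carrier_mat (d (Suc m)) (d 0)" using U Suc.prems(2) by auto
  have UT: "(W (Suc (Suc m)))\<^sup>T \<in> carrier_mat (d (Suc m)) (d (Suc (Suc m)))" using U by auto
  let ?b = "weight_prod (\<lambda>i. d (Suc i)) (\<lambda>i. W (Suc i)) m"
  have bT: "?b\<^sup>T \<in> carrier_mat (d (Suc 0)) (d (Suc m))" using b by simp
  have "weight_grad d W (Suc (Suc m)) N 1 = weight_grad d W (Suc m) ((W (Suc (Suc m)))\<^sup>T * N) 1"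
    by simp
  also have "\<dots> = ?b\<^sup>T * ((W (Suc (Suc m)))\<^sup>T * N)" by (rule Suc.IH[OF W UN])
  also have "\<dots> = ?b\<^sup>T * (W (Suc (Suc m)))\<^sup>T * N"
    by (rule assoc_mult_mat[OF bT UT Suc.prems(2), symmetric])
  also have "?b\<^sup>T * (W (Suc (Suc m)))\<^sup>T = (W (Suc (Suc m)) * ?b)\<^sup>T"
    by (rule transpose_mult[OF U b, symmetric])
  finally show ?case by simp
qed

lemma frob_norm_le_weight_norm:
  assumes "k \<in> {1..l}"
  shows "frob_norm (H k) \<le> weight_norm l H"
  unfolding frob_norm_def weight_norm_def weight_inner_def
  by (intro real_sqrt_le_mono member_le_sum assms)
    (auto simp: frob_inner_def sum_nonneg)

lemma weight_norm_nonneg: "0 \<le> weight_norm l H"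
  by (simp add: weight_norm_def weight_inner_def frob_inner_def sum_nonneg)

lemma frob_norm_diff_le_weight_norm:
  assumes "k \<in> {1..l}"
  shows "frob_norm (V k - W k) \<le> weight_norm l (weight_diff l V W)"
  using frob_norm_le_weight_norm[OF assms, of "weight_diff l V W"] assms
  by (simp add: weight_diff_def)

lemma mat_telescope_left:
  fixes A B C :: "real mat"
  assumes "A \<in> carrier_mat r c" "B \<in> carrier_mat r c" "C \<in> carrier_mat r c"
  shows "A - C = (B - C) + (A - B)"
  using assms by (intro eq_matI) auto

text \<open>With residual \<open>N\<close>, product difference \<open>\<Delta>\<close> and its linear part \<open>D\<close>, the error of the linear
approximation is \<open>2 \<langle>N, (\<Delta> - D) X\<rangle> + \<parallel>\<Delta> X\<parallel>\<^sup>2\<close>, which is of second order in the perturbation.\<close>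

lemma has_gradient_f_n:
  assumes W: "conforms l d W" and X: "X \<in> carrier_mat (d 0) n" and Y: "Y \<in> carrier_mat (d l) n"
  shows "has_gradient l d (f_n l d X Y) W
    (weight_grad d W l (2 \<cdot>\<^sub>m ((weight_prod d W l * X - Y) * X\<^sup>T)))"
proof -
  let ?w = "weight_prod d W l" 
  let ?N = "?w * X - Y"
  let ?G = "weight_grad d W l (2 \<cdot>\<^sub>m (?N * X\<^sup>T))"
  note w = weight_prod_carrier[OF W]
  have XT: "X\<^sup>T \<in> carrier_mat n (d 0)" using X by simp
  have N: "?N \<in> carrier_mat (d l) n" using w X Y by auto
  have NX: "?N * X\<^sup>T \<in> carrier_mat (d l) (d 0)" using N XT by auto
  then have NX2: "2 \<cdot>\<^sub>m (?N * X\<^sup>T) \<in> carrier_mat (d l) (d 0)" by auto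
  obtain C where C: "C \<ge> 0"
    and lip: "\<And>V t. \<lbrakk>conforms l d V; 0 \<le> t; t \<le> 1; \<And>k. k \<in> {1..l} \<Longrightarrow> frob_norm (V k - W k) \<le> t\<rbrakk>
      \<Longrightarrow> frob_norm (weight_prod d V l - ?w) \<le> C * t"
    and taylor: "\<And>V t. \<lbrakk>conforms l d V; 0 \<le> t; t \<le> 1; \<And>k. k \<in> {1..l} \<Longrightarrow> frob_norm (V k - W k) \<le> t\<rbrakk>
      \<Longrightarrow> frob_norm (weight_prod d V l - ?w - weight_deriv d W (\<lambda>k. V k - W k) l) \<le> C * t\<^sup>2"
    using weight_prod_expansion[OF W] by auto
  define K where "K = 2 * frob_norm ?N * C * frob_norm X + C\<^sup>2 * (frob_norm X)\<^sup>2"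
  have K: "K \<ge> 0" using C by (simp add: K_def frob_norm_nonneg)
  have bound: "\<bar>f_n l d X Y V - f_n l d X Y W - weight_inner l ?G (weight_diff l V W)\<bar> \<le> K * t\<^sup>2"
    if V: "conforms l d V" and t: "t = weight_norm l (weight_diff l V W)" "t \<le> 1" for V t
  proof -
    let ?v = "weight_prod d V l"
    let ?H = "weight_diff l V W"
    let ?D = "weight_deriv d W ?H l"
    have D_eq: "weight_deriv d W (\<lambda>k. V k - W k) l = ?D"
      by (rule weight_deriv_cong) (simp add: weight_diff_def)
    have t0: "0 \<le> t" using t weight_norm_nonneg by simp
    have le: "frob_norm (V k - W k) \<le> t" if "k \<in> {1..l}" for k
      using frob_norm_diff_le_weight_norm[OF that] t by simp
    have L: "frob_norm (?v - ?w) \<le> C * t" by (rule lip[OF V t0 t(2) le])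
    have T: "frob_norm (?v - ?w - ?D) \<le> C * t\<^sup>2" using taylor[OF V t0 t(2) le] by (simp add: D_eq)
    have H: "conforms l d ?H"
      using conforms_diff[OF V W] by (simp add: conforms_def weight_diff_def)
    note v = weight_prod_carrier[OF V] and D = weight_deriv_carrier[OF W H]
    have vw: "?v - ?w \<in> carrier_mat (d l) (d 0)" "?v - ?w - ?D \<in> carrier_mat (d l) (d 0)"
      using v w D by auto
    have E: "(?v - ?w) * X \<in> carrier_mat (d l) n" using vw X by auto
    have DX: "?D * X \<in> carrier_mat (d l) n" using D X by auto
    have "?v * X - Y = ?N + (?v - ?w) * X"
      unfolding minus_mult_distrib_mat[OF v w X]
      by (rule mat_telescope_left[OF mult_carrier_mat[OF v X] mult_carrier_mat[OF w X] Y])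
    then have "f_n l d X Y V
        = f_n l d X Y W + 2 * frob_inner ?N ((?v - ?w) * X) + (frob_norm ((?v - ?w) * X))\<^sup>2"
      unfolding f_n_def using frob_norm_add_power2[OF N E] by simp
    moreover have "weight_inner l ?G ?H = 2 * frob_inner ?N (?D * X)"
    proof -
      have "weight_inner l ?G ?H = 2 * frob_inner (?N * X\<^sup>T) ?D"
        using weight_inner_weight_grad[OF W H NX2] by (simp add: frob_inner_smult_left[OF NX])
      also have "frob_inner (?N * X\<^sup>T) ?D = frob_inner (?D * X) ?N"
        using frob_inner_mult_left[OF D X N] frob_inner_commute[OF NX D] by simp
      also have "\<dots> = frob_inner ?N (?D * X)" by (rule frob_inner_commute[OF DX N])
      finally show ?thesis .
    qed
    moreover have "frob_inner ?N ((?v - ?w - ?D) * X)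
        = frob_inner ?N ((?v - ?w) * X) - frob_inner ?N (?D * X)"
      unfolding minus_mult_distrib_mat[OF vw(1) D X] by (rule frob_inner_minus_right[OF N E DX])
    ultimately have eq: "f_n l d X Y V - f_n l d X Y W - weight_inner l ?G ?H
        = 2 * frob_inner ?N ((?v - ?w - ?D) * X) + (frob_norm ((?v - ?w) * X))\<^sup>2" by simp
    have "\<bar>frob_inner ?N ((?v - ?w - ?D) * X)\<bar> \<le> frob_norm ?N * frob_norm ((?v - ?w - ?D) * X)"
      using vw X by (intro frob_inner_le_norms[OF N]) auto
    also have "\<dots> \<le> frob_norm ?N * (frob_norm (?v - ?w - ?D) * frob_norm X)"
      by (intro mult_left_mono frob_norm_mult_le[OF vw(2) X] frob_norm_nonneg)
    also have "\<dots> \<le> frob_norm ?N * (C * t\<^sup>2 * frob_norm X)"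
      by (intro mult_left_mono mult_right_mono T frob_norm_nonneg)
    finally have 1: "\<bar>frob_inner ?N ((?v - ?w - ?D) * X)\<bar> \<le> frob_norm ?N * (C * t\<^sup>2 * frob_norm X)" .
    have "frob_norm ((?v - ?w) * X) \<le> frob_norm (?v - ?w) * frob_norm X"
      by (rule frob_norm_mult_le[OF vw(1) X])
    also have "\<dots> \<le> C * t * frob_norm X" by (intro mult_right_mono L frob_norm_nonneg)
    finally have "(frob_norm ((?v - ?w) * X))\<^sup>2 \<le> (C * t * frob_norm X)\<^sup>2"
      by (intro power_mono frob_norm_nonneg)
    with 1 have "\<bar>2 * frob_inner ?N ((?v - ?w - ?D) * X) + (frob_norm ((?v - ?w) * X))\<^sup>2\<bar>
        \<le> 2 * (frob_norm ?N * (C * t\<^sup>2 * frob_norm X)) + (C * t * frob_norm X)\<^sup>2"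
      using zero_le_power2[of "frob_norm ((?v - ?w) * X)"] by linarith
    also have "\<dots> = K * t\<^sup>2" by (simp add: K_def power_mult_distrib algebra_simps)
    finally show ?thesis unfolding eq .
  qed
  show ?thesis
    unfolding has_gradient_def
  proof (intro conjI allI impI)
    show "?G \<in> weight_space l d" by (rule weight_grad_in_weight_space[OF W NX2])
  next
    fix \<epsilon> :: real assume \<epsilon>: "0 < \<epsilon>"
    show "\<exists>\<delta>>0. \<forall>V\<in>weight_space l d. weight_norm l (weight_diff l V W) < \<delta> \<longrightarrow>
        \<bar>f_n l d X Y V - f_n l d X Y W - weight_inner l ?G (weight_diff l V W)\<bar>
          \<le> \<epsilon> * weight_norm l (weight_diff l V W)"
    proof (intro exI[of _ "min 1 (\<epsilon> / (K + 1))"] conjI ballI impI)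
      show "0 < min 1 (\<epsilon> / (K + 1))" using \<epsilon> K by simp
    next
      fix V assume V: "V \<in> weight_space l d"
        and small: "weight_norm l (weight_diff l V W) < min 1 (\<epsilon> / (K + 1))"
      define t where "t = weight_norm l (weight_diff l V W)"
      have t: "0 \<le> t" "t \<le> 1" "t < \<epsilon> / (K + 1)"
        using small weight_norm_nonneg by (auto simp: t_def)
      have "(K + 1) * t \<le> \<epsilon>" using t(3) K by (simp add: field_simps)
      then have "K * t \<le> \<epsilon>" using t(1) by (simp add: algebra_simps)
      then have "K * t\<^sup>2 \<le> \<epsilon> * t"
        using t(1) mult_right_mono[of "K * t" \<epsilon> t] by (simp add: power2_eq_square mult.assoc)
      then show "\<bar>f_n l d X Y V - f_n l d X Y W - weight_inner l ?G (weight_diff l V W)\<bar>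
          \<le> \<epsilon> * weight_norm l (weight_diff l V W)"
        using bound[OF weight_space_conforms[OF V] t_def t(2)] by (simp add: t_def)
    qed
  qed
qed

section \<open>The lower bound on the gradient near a global minimum\<close>

text \<open>From \<open>M = R\<^sup>T B0\<^sup>T M = R\<^sup>T (B\<^sup>T M + (B0 - B)\<^sup>T M)\<close>: if \<open>B\<close> is close to \<open>B0\<close>, the second summand contributes
at most half of \<open>\<parallel>M\<parallel>\<close> and can be absorbed into the left-hand side.\<close>

lemma frob_norm_le_transpose_mult_near_right_invertible:
  assumes B: "B \<in> carrier_mat r c" and B0: "B0 \<in> carrier_mat r c" and R: "R \<in> carrier_mat c r"
    and inv: "B0 * R = 1\<^sub>m r" and near: "frob_norm (B - B0) * frob_norm R \<le> 1 / 2"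
    and M: "M \<in> carrier_mat r s"
  shows "frob_norm M \<le> 2 * frob_norm R * frob_norm (B\<^sup>T * M)"
proof -
  have BT: "B\<^sup>T \<in> carrier_mat c r" "B0\<^sup>T \<in> carrier_mat c r" "(B0 - B)\<^sup>T \<in> carrier_mat c r"
    and RT: "R\<^sup>T \<in> carrier_mat r c" using B B0 R by auto
  have BM: "B\<^sup>T * M \<in> carrier_mat c s" "(B0 - B)\<^sup>T * M \<in> carrier_mat c s"
    using mult_carrier_mat[OF BT(1) M] mult_carrier_mat[OF BT(3) M] by blast+
  have "M = (B0 * R)\<^sup>T * M" using inv M by simp
  also have "\<dots> = R\<^sup>T * (B0\<^sup>T * M)"
    using transpose_mult[OF B0 R] assoc_mult_mat[OF RT BT(2) M] by simp
  also have "B0\<^sup>T * M = B\<^sup>T * M + (B0 - B)\<^sup>T * M"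
    unfolding transpose_minus[OF B0 B] minus_mult_distrib_mat[OF BT(2,1) M]
    using BT M by (intro eq_matI) auto
  finally have "frob_norm M = frob_norm (R\<^sup>T * (B\<^sup>T * M + (B0 - B)\<^sup>T * M))" by simp
  also have "\<dots> \<le> frob_norm R\<^sup>T * frob_norm (B\<^sup>T * M + (B0 - B)\<^sup>T * M)"
    by (rule frob_norm_mult_le[OF RT add_carrier_mat[OF BM(2)]])
  also have "\<dots> \<le> frob_norm R\<^sup>T * (frob_norm (B\<^sup>T * M) + frob_norm ((B0 - B)\<^sup>T * M))"
    by (intro mult_left_mono frob_norm_triangle[OF BM] frob_norm_nonneg)
  also have "\<dots> \<le> frob_norm R\<^sup>T * (frob_norm (B\<^sup>T * M) + frob_norm (B0 - B)\<^sup>T * frob_norm M)"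
    by (intro mult_left_mono add_left_mono frob_norm_mult_le[OF BT(3) M] frob_norm_nonneg)
  also have "\<dots> = frob_norm R * frob_norm (B\<^sup>T * M) + (frob_norm (B - B0) * frob_norm R) * frob_norm M"
  proof -
    have "B0 - B = (- 1) \<cdot>\<^sub>m (B - B0)" using B B0 by (intro eq_matI) auto
    then have "frob_norm (B0 - B) = frob_norm (B - B0)" by (simp add: frob_norm_smult)
    then show ?thesis by (simp add: frob_norm_transpose algebra_simps)
  qed
  also have "\<dots> \<le> frob_norm R * frob_norm (B\<^sup>T * M) + 1 / 2 * frob_norm M"
    by (intro add_left_mono mult_right_mono near frob_norm_nonneg)
  finally show ?thesis by simp
qed

text \<open>The competitor is a factorization of \<open>Y Q\<^sup>T\<close>, for which \<open>Y Q\<^sup>T X = Y P\<^sup>T = Y P\<close>.\<close>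

lemma global_min_product:
  assumes "l > 0" and X: "X \<in> carrier_mat (d 0) n" and Y: "Y \<in> carrier_mat (d l) n"
    and P: "is_orth_proj_onto n (vec_space.col_space n X\<^sup>T) P"
    and wide: "\<And>k. k \<in> {1..<l} \<Longrightarrow> d k \<ge> d 0"
    and min: "is_arg_min (f_n l d X Y) (\<lambda>W. W \<in> weight_space l d) W0"
  shows "weight_prod d W0 l * X = Y * P"
proof -
  from P have Pc: "P \<in> carrier_mat n n" by (simp add: is_orth_proj_onto_def)
  obtain Q where Q: "Q \<in> carrier_mat (d 0) n" "X\<^sup>T * Q = P" and XP: "X * P = X"
    and PT: "P\<^sup>T = P" and PP: "P * P = P"
    by (rule orth_proj_onto_row_space[OF X P])
  note pyth = frob_norm_residual_pythagoras[OF X Y Pc XP PT PP]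
  have W0: "W0 \<in> weight_space l d"
    and le: "\<And>V. V \<in> weight_space l d \<Longrightarrow> f_n l d X Y W0 \<le> f_n l d X Y V"
    using min by (auto simp: is_arg_min_def not_less)
  note A0 = weight_prod_carrier[OF weight_space_conforms[OF W0]]
  have QT: "Q\<^sup>T \<in> carrier_mat n (d 0)" using Q by simp
  have YQ: "Y * Q\<^sup>T \<in> carrier_mat (d l) (d 0)" using Y QT by auto
  obtain V where V: "V \<in> weight_space l d" "weight_prod d V l = Y * Q\<^sup>T"
    using weight_prod_surj[OF assms(1) YQ wide] by blast
  have "Y * Q\<^sup>T * X = Y * (Q\<^sup>T * X)" by (rule assoc_mult_mat[OF Y QT X])
  also have "Q\<^sup>T * X = P" using transpose_mult[of "X\<^sup>T" n "d 0" Q n] X Q PT by simp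
  finally have VX: "weight_prod d V l * X = Y * P" using V(2) by simp
  have "Y * P - Y * P = 0\<^sub>m (d l) n" using Y Pc by auto
  then have "frob_norm (Y * P - Y * P) = 0" by (simp add: frob_norm_def frob_inner_def)
  moreover have "f_n l d X Y W0 \<le> f_n l d X Y V" by (rule le[OF V(1)])
  ultimately have "(frob_norm (weight_prod d W0 l * X - Y * P))\<^sup>2 \<le> 0"
    unfolding f_n_def using pyth[OF A0] pyth[of "weight_prod d V l"] YQ V(2) VX by simp
  then have "frob_norm (weight_prod d W0 l * X - Y * P) = 0" by simp
  moreover have "weight_prod d W0 l * X - Y * P \<in> carrier_mat (d l) n" using A0 X Y Pc by auto
  ultimately have "weight_prod d W0 l * X - Y * P = 0\<^sub>m (d l) n" by (metis frob_norm_eq_0_imp)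
  then show ?thesis
    using minus_r_inv_mat mult_carrier_mat[OF A0 X] mult_carrier_mat[OF Y Pc]
    by (metis eq_iff_diff_eq_0 eq_matI carrier_matD index_minus_mat(1) index_zero_mat(1))
qed

theorem proposition4p19:
  fixes l n :: nat and d :: "nat \<Rightarrow> nat"
    and X Y P :: "real mat" and W0 :: "nat \<Rightarrow> real mat"
  assumes "l > 0" and "n > 0" and "\<And>k. k \<le> l \<Longrightarrow> d k > 0"
    and "X \<in> carrier_mat (d 0) n" and "Y \<in> carrier_mat (d l) n"
    and "is_orth_proj_onto n (vec_space.col_space n X\<^sup>T) P"
    and "\<And>k. k \<in> {1..<l} \<Longrightarrow> d k \<ge> d 0"
    and "vec_space.rank (d l) (Y * P) = d l"
    and "is_arg_min (f_n l d X Y) (\<lambda>W. W \<in> weight_space l d) W0"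
  shows "KL_exponent l d (f_n l d X Y) (1/2) W0"
proof -
  note X = assms(4) and Y = assms(5)
  from assms(6) have P: "P \<in> carrier_mat n n" by (simp add: is_orth_proj_onto_def)
  obtain Q where Q: "Q \<in> carrier_mat (d 0) n" "X\<^sup>T * Q = P" and XP: "X * P = X"
    and PT: "P\<^sup>T = P" and PP: "P * P = P"
    by (rule orth_proj_onto_row_space[OF X assms(6)])
  note pyth = frob_norm_residual_pythagoras[OF X Y P XP PT PP]
  have W0: "conforms l d W0" using assms(9) by (auto simp: is_arg_min_def weight_space_conforms)
  obtain m where l: "l = Suc m" using assms(1) by (cases l) auto
  define B where "B W = weight_prod (\<lambda>i. d (Suc i)) (\<lambda>i. W (Suc i)) m" for W
  have B: "B W \<in> carrier_mat (d l) (d 1)" if "conforms l d W" for W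
    using weight_prod_carrier[OF conforms_shift[OF that[unfolded l]]] by (simp add: B_def l)
  have split: "weight_prod d W l = B W * W 1" if "conforms l d W" for W
    using weight_prod_first_factor[OF that[unfolded l]] by (simp add: B_def l)
  have W01: "W0 1 \<in> carrier_mat (d 1) (d 0)" using conforms_first_factor[OF W0[unfolded l]] .
  have opt: "weight_prod d W0 l * X = Y * P"
    by (rule global_min_product[OF assms(1) X Y assms(6,7,9)])
  \<comment> \<open>Since \<open>Y P = B W\<^sub>1 X\<close> at the minimum, a right inverse of \<open>Y P\<close> gives one of \<open>B\<close>.\<close>
  obtain R where R: "R \<in> carrier_mat (d 1) (d l)" and B0R: "B W0 * R = 1\<^sub>m (d l)"
  proof -
    obtain S where S: "S \<in> carrier_mat n (d l)" "Y * P * S = 1\<^sub>m (d l)"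
      using right_inverse_of_full_row_rank[OF mult_carrier_mat[OF Y P] assms(8)] by blast
    note WX = mult_carrier_mat[OF W01 X]
    have "B W0 * (W0 1 * X * S) = B W0 * (W0 1 * X) * S"
      by (rule assoc_mult_mat[OF B[OF W0] WX S(1), symmetric])
    also have "B W0 * (W0 1 * X) = Y * P"
      using assoc_mult_mat[OF B[OF W0] W01 X] opt split[OF W0] by simp
    also note S(2)
    finally show ?thesis using that mult_carrier_mat[OF WX S(1)] by blast
  qed
  obtain C where C: "C \<ge> 0" and
    lip': "\<forall>V t. conforms m (\<lambda>i. d (Suc i)) V \<longrightarrow> 0 \<le> t \<longrightarrow> t \<le> 1 \<longrightarrow>
        (\<forall>k\<in>{1..m}. frob_norm (V k - W0 (Suc k)) \<le> t) \<longrightarrow>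
        frob_norm (weight_prod (\<lambda>i. d (Suc i)) V m
            - weight_prod (\<lambda>i. d (Suc i)) (\<lambda>i. W0 (Suc i)) m) \<le> C * t"
    using weight_prod_expansion[OF conforms_shift[OF W0[unfolded l]]] by metis
  have lip: "frob_norm (B W - B W0) \<le> C * t"
    if "conforms l d W" "0 \<le> t" "t \<le> 1" "\<And>k. k \<in> {1..l} \<Longrightarrow> frob_norm (W k - W0 k) \<le> t" for W t
    unfolding B_def
    using lip'[rule_format, OF conforms_shift[OF that(1)[unfolded l]] that(2,3)] that(4) l by auto
  \<comment> \<open>The radius makes \<open>\<parallel>B W - B W0\<parallel> r \<le> 1/2\<close>.  The two lower bounds lose the factors \<open>r\<close> and \<open>q\<close>, and
     adding 1 keeps all divisors positive even where \<open>r\<close>, \<open>q\<close> or \<open>C\<close> vanishes.\<close>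
  define r where "r = frob_norm R"
  define q where "q = frob_norm Q"
  define \<rho> where "\<rho> = min 1 (1 / (2 * C * r + 1))"
  define c where "c = 1 / (r * q + 1)"
  have r: "r \<ge> 0" and q: "q \<ge> 0" by (auto simp: r_def q_def frob_norm_nonneg)
  have \<rho>: "\<rho> > 0" "\<rho> \<le> 1" using C r by (auto simp: \<rho>_def add_nonneg_pos)
  have c: "c > 0" using r q by (simp add: c_def add_nonneg_pos)
  have "\<exists>G. has_gradient l d (f_n l d X Y) W G
        \<and> c * (f_n l d X Y W - f_n l d X Y W0) powr (1/2) \<le> weight_norm l G"
    if W': "W \<in> weight_space l d" and near: "weight_norm l (weight_diff l W W0) < \<rho>" for W
  proof -
    note W = weight_space_conforms[OF W']
    define M where "M = weight_prod d W l * X - Y * P"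
    define E where "E = (weight_prod d W l * X - Y) * X\<^sup>T"
    note w = weight_prod_carrier[OF W]
    have E: "E \<in> carrier_mat (d l) (d 0)" using w X Y by (auto simp: E_def)
    then have E2: "2 \<cdot>\<^sub>m E \<in> carrier_mat (d l) (d 0)" by simp
    let ?G = "weight_grad d W l (2 \<cdot>\<^sub>m E)"
    have gap: "f_n l d X Y W - f_n l d X Y W0 = (frob_norm M)\<^sup>2"
    proof -
      have "Y * P - Y * P = 0\<^sub>m (d l) n" using Y P by auto
      then have "frob_norm (Y * P - Y * P) = 0" by (simp add: frob_norm_def frob_inner_def)
      then show ?thesis
        using pyth[OF w] pyth[OF weight_prod_carrier[OF W0]] opt by (simp add: f_n_def M_def)
    qed
    have BBR: "frob_norm (B W - B W0) * frob_norm R \<le> 1 / 2"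
    proof -
      let ?t = "weight_norm l (weight_diff l W W0)"
      have "frob_norm (B W - B W0) \<le> C * ?t"
        using near \<rho> by (intro lip[OF W weight_norm_nonneg] frob_norm_diff_le_weight_norm) auto
      also have "\<dots> \<le> C * (1 / (2 * C * r + 1))"
        using near by (intro mult_left_mono C) (auto simp: \<rho>_def)
      finally have "frob_norm (B W - B W0) * r \<le> C * (1 / (2 * C * r + 1)) * r"
        by (rule mult_right_mono[OF _ r])
      also have "\<dots> = C * r / (2 * (C * r) + 1)" by (simp add: mult_ac)
      also have "\<dots> \<le> 1 / 2"
        using mult_nonneg_nonneg[OF C r] by (simp add: divide_le_eq add_nonneg_pos)
      finally show ?thesis by (simp add: r_def)
    qed
    have "frob_norm M \<le> frob_norm E * q"
      unfolding M_def E_def q_def by (rule frob_norm_residual_le[OF X Y P XP PT PP w Q])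
    also have "\<dots> \<le> 2 * r * frob_norm ((B W)\<^sup>T * E) * q"
      unfolding r_def
      by (intro mult_right_mono q
          frob_norm_le_transpose_mult_near_right_invertible[OF B[OF W] B[OF W0] R B0R BBR E])
    also have "\<dots> = r * q * (2 * frob_norm ((B W)\<^sup>T * E))" by (simp add: mult_ac)
    also have "2 * frob_norm ((B W)\<^sup>T * E) = frob_norm (?G 1)"
    proof -
      have "?G 1 = (B W)\<^sup>T * (2 \<cdot>\<^sub>m E)"
        using weight_grad_first_factor[OF W[unfolded l]] E2 by (simp add: B_def l)
      also have "\<dots> = 2 \<cdot>\<^sub>m ((B W)\<^sup>T * E)"
        using B[OF W] E by (intro mult_smult_distrib[of _ "d 1" "d l"]) auto
      finally show ?thesis by (simp add: frob_norm_smult)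
    qed
    also have "r * q * frob_norm (?G 1) \<le> (r * q + 1) * weight_norm l ?G"
      using r q assms(1) by (intro mult_mono frob_norm_le_weight_norm frob_norm_nonneg) auto
    finally have "c * frob_norm M \<le> weight_norm l ?G"
      using mult_nonneg_nonneg[OF r q] by (simp add: c_def field_simps)
    moreover have "(f_n l d X Y W - f_n l d X Y W0) powr (1/2) = frob_norm M"
      unfolding gap by (simp add: powr_half_sqrt frob_norm_nonneg)
    moreover have "has_gradient l d (f_n l d X Y) W ?G"
      unfolding E_def by (rule has_gradient_f_n[OF W X Y])
    ultimately show ?thesis by auto
  qed
  \<comment> \<open>The estimate holds at every gap, so any positive \<open>\<eta>\<close> will do.\<close>
  then show ?thesis
    unfolding KL_exponent_def using \<rho>(1) c
    by (intro conjI exI[of _ \<rho>] exI[of _ "1::real"] exI[of _ c]) auto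
qed

end
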